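(* Let $\mathbf M\to\mathbf A$ be a bifibrant functor, and let $(A_0,A_1,A_2,A_3,a,a_1,a_2,p_1,p_2,p_3)$ be objects and morphisms of $\mathbf A$, with $a:A_1\to A_0$, $a_1,a_2:A_2\to A_1$, $p_1,p_2,p_3:A_3\to A_2$, such that $aa_1=aa_2$, $a_1p_2=a_1p_3$, $a_1p_1=a_2p_3$, $a_2p_1=a_2p_2$. Assume that the weak exchange hypothesis (W) holds, that $a^*$ is fully faithful and that $\mathbf M(A_0)$ is Karoubian. Then: a) every unital $T^a$-algebra is associative (i.e. if $\phi:T^aM\to M$ satisfies $\phi\circ\eta^a_M=1_M$, then $\phi\circ T^a\phi=\phi\circ\mu^a_M$); b) the Eilenberg–Moore comparison functor $K^a:\mathbf M(A_0)\to\mathbf M^a$, $M_0\mapsto (a^*M_0,a^*\epsilon^a_{M_0})$, is essentially surjective.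
   Context: Bifibration: $P:\mathbf M\to\mathbf A$ is a bifibrant functor (a Grothendieck fibration and opfibration); $\mathbf M(A)$ is the fibre over $A\in\mathbf A$. For an arrow $a:A_1\to A_0$ of $\mathbf A$, $a^*:\mathbf M(A_0)\to\mathbf M(A_1)$ and $a_*:\mathbf M(A_1)\to\mathbf M(A_0)$ are the inverse and direct image functors; $a_*$ is left adjoint to $a^*$, with unit $\eta^a:\mathrm{Id}\Rightarrow a^*a_*$ and counit $\epsilon^a:a_*a^*\Rightarrow\mathrm{Id}$. $T^a=a^*a_*$ is the associated monad, with unit $\eta^a$ and multiplication $\mu^a=a^*\epsilon^aa_*$. Existence of fibre products in $\mathbf A$ is not assumed. The assignment $a\mapsto a^*$ is assumed strictly functorial ($(ab)^*=b^*a^*$, $1^*=\mathrm{Id}$), and the left adjoints are chosen so that $a\mapsto a_*$ is strictly functorial, adjunctions of composites being the composite adjunctions. Base change morphisms: $\chi:(a_2)_*a_1^*\Rightarrow T^a$, $\chi=\epsilon^{a_2}T^a\circ (a_2)_*a_1^*\eta^a$ (using $a_1^*a^*=a_2^*a^*$), and $\lambda:(p_1)_*p_3^*\Rightarrow a_1^*(a_2)_*$, $\lambda=\epsilon^{p_1}a_1^*(a_2)_*\circ (p_1)_*p_3^*\eta^{a_2}$ (using $p_3^*a_2^*=p_1^*a_1^*$). Weak exchange hypothesis (W): the base change morphisms $\chi$ and $\lambda$ are epi, i.e. all their components are epimorphisms. $\mathbf M^a$ is the category of (unital, associative) $T^a$-algebras in $\mathbf M(A_1)$. A category is Karoubian if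 every idempotent endomorphism has an image. *)

theory Defs
  imports Main
begin

section \<open>Categories and functors\<close>

record ('o, 'm) cat =
  Obj :: "'o set"
  Arr :: "'m set"
  Src :: "'m \<Rightarrow> 'o"
  Tgt :: "'m \<Rightarrow> 'o"
  Idt :: "'o \<Rightarrow> 'm"
  Cmp :: "'m \<Rightarrow> 'm \<Rightarrow> 'm"  (infixr "\<cdot>\<index>" 70)

definition hom :: "('o, 'm) cat \<Rightarrow> 'o \<Rightarrow> 'o \<Rightarrow> 'm set" where
  "hom C X Y = {f \<in> Arr C. Src C f = X \<and> Tgt C f = Y}"

locale category =
  fixes C :: "('o, 'm) cat" (structure)
  assumes Src_in: "f \<in> Arr C \<Longrightarrow> Src C f \<in> Obj C"
    and Tgt_in: "f \<in> Arr C \<Longrightarrow> Tgt C f \<in> Obj C"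
    and Idt_hom: "X \<in> Obj C \<Longrightarrow> Idt C X \<in> hom C X X"
    and Cmp_hom: "f \<in> hom C X Y \<Longrightarrow> g \<in> hom C Y Z \<Longrightarrow> g \<cdot> f \<in> hom C X Z"
    and Idt_left: "f \<in> hom C X Y \<Longrightarrow> Idt C Y \<cdot> f = f"
    and Idt_right: "f \<in> hom C X Y \<Longrightarrow> f \<cdot> Idt C X = f"
    and Cmp_assoc: "f \<in> hom C X Y \<Longrightarrow> g \<in> hom C Y Z \<Longrightarrow> h \<in> hom C Z W
          \<Longrightarrow> (h \<cdot> g) \<cdot> f = h \<cdot> (g \<cdot> f)"

definition epi :: "('o, 'm) cat \<Rightarrow> 'm \<Rightarrow> bool" where
  "epi C f \<longleftrightarrow> f \<in> Arr C \<and>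
     (\<forall>Z\<in>Obj C. \<forall>g\<in>hom C (Tgt C f) Z. \<forall>h\<in>hom C (Tgt C f) Z.
        g \<cdot>\<^bsub>C\<^esub> f = h \<cdot>\<^bsub>C\<^esub> f \<longrightarrow> g = h)"

definition isomorphic :: "('o, 'm) cat \<Rightarrow> 'o \<Rightarrow> 'o \<Rightarrow> bool" where
  "isomorphic C X Y \<longleftrightarrow> (\<exists>f\<in>hom C X Y. \<exists>g\<in>hom C Y X.
     g \<cdot>\<^bsub>C\<^esub> f = Idt C X \<and> f \<cdot>\<^bsub>C\<^esub> g = Idt C Y)"

text \<open>The image of an idempotent is meant in the sense of Karoubi and SGA 4: \<open>e\<close> factors as a
  retraction followed by a section of it. (For an idempotent this is the same as an equalizer of
  \<open>e\<close> and the identity. The least subobject through which \<open>e\<close> factors would be a weaker notion.)\<close>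

definition karoubian :: "('o, 'm) cat \<Rightarrow> bool" where
  "karoubian C \<longleftrightarrow> (\<forall>X\<in>Obj C. \<forall>e\<in>hom C X X. e \<cdot>\<^bsub>C\<^esub> e = e \<longrightarrow>
     (\<exists>I\<in>Obj C. \<exists>r\<in>hom C X I. \<exists>s\<in>hom C I X.
        s \<cdot>\<^bsub>C\<^esub> r = e \<and> r \<cdot>\<^bsub>C\<^esub> s = Idt C I))"

record ('o, 'm, 'p, 'n) ftor =
  omap :: "'o \<Rightarrow> 'p"
  amap :: "'m \<Rightarrow> 'n"

locale is_functor = source: category C + target: category D
  for C :: "('o, 'm) cat" and D :: "('p, 'n) cat" +
  fixes F :: "('o, 'm, 'p, 'n) ftor"
  assumes omap_in: "X \<in> Obj C \<Longrightarrow> omap F X \<in> Obj D"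
    and amap_hom: "f \<in> hom C X Y \<Longrightarrow> amap F f \<in> hom D (omap F X) (omap F Y)"
    and amap_Idt: "X \<in> Obj C \<Longrightarrow> amap F (Idt C X) = Idt D (omap F X)"
    and amap_Cmp: "f \<in> hom C X Y \<Longrightarrow> g \<in> hom C Y Z
          \<Longrightarrow> amap F (g \<cdot>\<^bsub>C\<^esub> f) = amap F g \<cdot>\<^bsub>D\<^esub> amap F f"

definition id_ftor :: "('o, 'm, 'o, 'm) ftor" where
  "id_ftor = \<lparr>omap = (\<lambda>X. X), amap = (\<lambda>f. f)\<rparr>"

definition ftor_comp ::
    "('p, 'n, 'q, 'l) ftor \<Rightarrow> ('o, 'm, 'p, 'n) ftor \<Rightarrow> ('o, 'm, 'q, 'l) ftor"
    (infixr "\<circ>\<^sub>F" 70) where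
  "G \<circ>\<^sub>F F = \<lparr>omap = (\<lambda>X. omap G (omap F X)), amap = (\<lambda>f. amap G (amap F f))\<rparr>"

text \<open>Equality of functors with source \<open>C\<close>; values outside \<open>C\<close> are irrelevant.\<close>

definition ftor_eq ::
    "('o, 'm) cat \<Rightarrow> ('o, 'm, 'p, 'n) ftor \<Rightarrow> ('o, 'm, 'p, 'n) ftor \<Rightarrow> bool" where
  "ftor_eq C F G \<longleftrightarrow>
     (\<forall>X\<in>Obj C. omap F X = omap G X) \<and> (\<forall>f\<in>Arr C. amap F f = amap G f)"

definition fully_faithful ::
    "('o, 'm) cat \<Rightarrow> ('p, 'n) cat \<Rightarrow> ('o, 'm, 'p, 'n) ftor \<Rightarrow> bool" where
  "fully_faithful C D F \<longleftrightarrow> (\<forall>X\<in>Obj C. \<forall>Y\<in>Obj C.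
     bij_betw (amap F) (hom C X Y) (hom D (omap F X) (omap F Y)))"

definition essentially_surjective ::
    "('o, 'm) cat \<Rightarrow> ('p, 'n) cat \<Rightarrow> ('o, 'm, 'p, 'n) ftor \<Rightarrow> bool" where
  "essentially_surjective C D F \<longleftrightarrow> (\<forall>Y\<in>Obj D. \<exists>X\<in>Obj C. isomorphic D (omap F X) Y)"


section \<open>Algebras over a monad\<close>

text \<open>\<open>T\<close>, \<open>\<eta>\<close>, \<open>\<mu>\<close> are the functor, unit and multiplication of a monad on \<open>C\<close>.\<close>

definition unital_algebra ::
    "('o, 'm) cat \<Rightarrow> ('o, 'm, 'o, 'm) ftor \<Rightarrow> ('o \<Rightarrow> 'm) \<Rightarrow> 'o \<Rightarrow> 'm \<Rightarrow> bool" where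
  "unital_algebra C T \<eta> X \<phi> \<longleftrightarrow>
     X \<in> Obj C \<and> \<phi> \<in> hom C (omap T X) X \<and> \<phi> \<cdot>\<^bsub>C\<^esub> \<eta> X = Idt C X"

definition associative_algebra ::
    "('o, 'm) cat \<Rightarrow> ('o, 'm, 'o, 'm) ftor \<Rightarrow> ('o \<Rightarrow> 'm) \<Rightarrow> 'o \<Rightarrow> 'm \<Rightarrow> bool" where
  "associative_algebra C T \<mu> X \<phi> \<longleftrightarrow>
     X \<in> Obj C \<and> \<phi> \<in> hom C (omap T X) X \<and> \<phi> \<cdot>\<^bsub>C\<^esub> amap T \<phi> = \<phi> \<cdot>\<^bsub>C\<^esub> \<mu> X"

text \<open>The category of unital associative algebras. An arrow carries its source and target
  algebras: \<open>((X, \<phi>), f, (Y, \<psi>))\<close>.\<close>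

definition algebras ::
    "('o, 'm) cat \<Rightarrow> ('o, 'm, 'o, 'm) ftor \<Rightarrow> ('o \<Rightarrow> 'm) \<Rightarrow> ('o \<Rightarrow> 'm)
      \<Rightarrow> ('o \<times> 'm, ('o \<times> 'm) \<times> 'm \<times> ('o \<times> 'm)) cat" where
  "algebras C T \<eta> \<mu> =
     (let Alg = {(X, \<phi>). unital_algebra C T \<eta> X \<phi> \<and> associative_algebra C T \<mu> X \<phi>} in
      \<lparr>Obj = Alg,
       Arr = {((X, \<phi>), f, (Y, \<psi>)). (X, \<phi>) \<in> Alg \<and> (Y, \<psi>) \<in> Alg \<and>
                f \<in> hom C X Y \<and> f \<cdot>\<^bsub>C\<^esub> \<phi> = \<psi> \<cdot>\<^bsub>C\<^esub> amap T f},
       Src = (\<lambda>(x, f, y). x),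
       Tgt = (\<lambda>(x, f, y). y),
       Idt = (\<lambda>(X, \<phi>). ((X, \<phi>), Idt C X, (X, \<phi>))),
       Cmp = (\<lambda>(y, g, z) (x, f, y'). (x, g \<cdot>\<^bsub>C\<^esub> f, z))\<rparr>)"


section \<open>Fibrations and opfibrations\<close>

definition cartesian ::
    "('o, 'm) cat \<Rightarrow> ('p, 'n) cat \<Rightarrow> ('o, 'm, 'p, 'n) ftor \<Rightarrow> 'm \<Rightarrow> bool" where
  "cartesian M A P f \<longleftrightarrow> f \<in> Arr M \<and>
     (\<forall>X\<in>Obj M. \<forall>g\<in>hom M X (Tgt M f). \<forall>u\<in>hom A (omap P X) (omap P (Src M f)).
        amap P g = amap P f \<cdot>\<^bsub>A\<^esub> u \<longrightarrow>
        (\<exists>!h. h \<in> hom M X (Src M f) \<and> amap P h = u \<and> f \<cdot>\<^bsub>M\<^esub> h = g))"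

definition opcartesian ::
    "('o, 'm) cat \<Rightarrow> ('p, 'n) cat \<Rightarrow> ('o, 'm, 'p, 'n) ftor \<Rightarrow> 'm \<Rightarrow> bool" where
  "opcartesian M A P f \<longleftrightarrow> f \<in> Arr M \<and>
     (\<forall>Y\<in>Obj M. \<forall>g\<in>hom M (Src M f) Y. \<forall>u\<in>hom A (omap P (Tgt M f)) (omap P Y).
        amap P g = u \<cdot>\<^bsub>A\<^esub> amap P f \<longrightarrow>
        (\<exists>!h. h \<in> hom M (Tgt M f) Y \<and> amap P h = u \<and> h \<cdot>\<^bsub>M\<^esub> f = g))"

definition fibration ::
    "('o, 'm) cat \<Rightarrow> ('p, 'n) cat \<Rightarrow> ('o, 'm, 'p, 'n) ftor \<Rightarrow> bool" where
  "fibration M A P \<longleftrightarrow> is_functor M A P \<and>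
     (\<forall>a\<in>Arr A. \<forall>Y\<in>Obj M. omap P Y = Tgt A a \<longrightarrow>
        (\<exists>f. cartesian M A P f \<and> amap P f = a \<and> Tgt M f = Y))"

definition opfibration ::
    "('o, 'm) cat \<Rightarrow> ('p, 'n) cat \<Rightarrow> ('o, 'm, 'p, 'n) ftor \<Rightarrow> bool" where
  "opfibration M A P \<longleftrightarrow> is_functor M A P \<and>
     (\<forall>a\<in>Arr A. \<forall>X\<in>Obj M. omap P X = Src A a \<longrightarrow>
        (\<exists>f. opcartesian M A P f \<and> amap P f = a \<and> Src M f = X))"

definition bifibrant ::
    "('o, 'm) cat \<Rightarrow> ('p, 'n) cat \<Rightarrow> ('o, 'm, 'p, 'n) ftor \<Rightarrow> bool" where
  "bifibrant M A P \<longleftrightarrow> fibration M A P \<and> opfibration M A P"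


section \<open>Inverse and direct images\<close>

text \<open>A functor \<open>Proj\<close> from \<open>Tot\<close> to \<open>Base\<close> with chosen lifts: \<open>Lift a Y\<close> is a cartesian arrow
  over \<open>a\<close> with target \<open>Y\<close>, and \<open>Oplift a X\<close> an opcartesian arrow over \<open>a\<close> with source \<open>X\<close>.
  Choosing \<open>Oplift a\<close> amounts to choosing a left adjoint of the inverse image functor along \<open>a\<close>
  together with the unit and counit.\<close>

record ('o, 'm, 'p, 'n) bifib =
  Tot :: "('o, 'm) cat"
  Base :: "('p, 'n) cat"
  Proj :: "('o, 'm, 'p, 'n) ftor"
  Lift :: "'n \<Rightarrow> 'o \<Rightarrow> 'm"
  Oplift :: "'n \<Rightarrow> 'o \<Rightarrow> 'm"

definition fibre :: "('o, 'm, 'p, 'n) bifib \<Rightarrow> 'p \<Rightarrow> ('o, 'm) cat" where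
  "fibre B A = (Tot B)
     \<lparr>Obj := {X \<in> Obj (Tot B). omap (Proj B) X = A},
      Arr := {f \<in> Arr (Tot B). omap (Proj B) (Src (Tot B) f) = A \<and>
                omap (Proj B) (Tgt (Tot B) f) = A \<and> amap (Proj B) f = Idt (Base B) A}\<rparr>"

definition inverse_image :: "('o, 'm, 'p, 'n) bifib \<Rightarrow> 'n \<Rightarrow> ('o, 'm, 'o, 'm) ftor" where
  "inverse_image B a =
     \<lparr>omap = (\<lambda>Y. Src (Tot B) (Lift B a Y)),
      amap = (\<lambda>f. let Y = Src (Tot B) f; Y' = Tgt (Tot B) f in
        THE h. h \<in> hom (fibre B (Src (Base B) a))
                   (Src (Tot B) (Lift B a Y)) (Src (Tot B) (Lift B a Y')) \<and>
               Lift B a Y' \<cdot>\<^bsub>Tot B\<^esub> h = f \<cdot>\<^bsub>Tot B\<^esub> Lift B a Y)\<rparr>"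

definition direct_image :: "('o, 'm, 'p, 'n) bifib \<Rightarrow> 'n \<Rightarrow> ('o, 'm, 'o, 'm) ftor" where
  "direct_image B a =
     \<lparr>omap = (\<lambda>X. Tgt (Tot B) (Oplift B a X)),
      amap = (\<lambda>f. let X = Src (Tot B) f; X' = Tgt (Tot B) f in
        THE h. h \<in> hom (fibre B (Tgt (Base B) a))
                   (Tgt (Tot B) (Oplift B a X)) (Tgt (Tot B) (Oplift B a X')) \<and>
               h \<cdot>\<^bsub>Tot B\<^esub> Oplift B a X = Oplift B a X' \<cdot>\<^bsub>Tot B\<^esub> f)\<rparr>"

text \<open>Arrows over \<open>a\<close> from \<open>X\<close> to \<open>Y\<close> correspond, by the two chosen lifts, to vertical arrows from
  \<open>X\<close> to the inverse image of \<open>Y\<close> and to vertical arrows from the direct image of \<open>X\<close> to \<open>Y\<close>.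
  This is the adjunction, so its unit corresponds to \<open>Oplift a X\<close> and its counit to \<open>Lift a Y\<close>.\<close>

definition adj_unit :: "('o, 'm, 'p, 'n) bifib \<Rightarrow> 'n \<Rightarrow> 'o \<Rightarrow> 'm" where
  "adj_unit B a X = (THE h.
     h \<in> hom (fibre B (Src (Base B) a)) X (omap (inverse_image B a) (omap (direct_image B a) X)) \<and>
     Lift B a (omap (direct_image B a) X) \<cdot>\<^bsub>Tot B\<^esub> h = Oplift B a X)"

definition adj_counit :: "('o, 'm, 'p, 'n) bifib \<Rightarrow> 'n \<Rightarrow> 'o \<Rightarrow> 'm" where
  "adj_counit B a Y = (THE h.
     h \<in> hom (fibre B (Tgt (Base B) a)) (omap (direct_image B a) (omap (inverse_image B a) Y)) Y \<and>
     h \<cdot>\<^bsub>Tot B\<^esub> Oplift B a (omap (inverse_image B a) Y) = Lift B a Y)"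

definition chosen_lifts :: "('o, 'm, 'p, 'n) bifib \<Rightarrow> bool" where
  "chosen_lifts B \<longleftrightarrow> (\<forall>a\<in>Arr (Base B).
     (\<forall>Y\<in>Obj (fibre B (Tgt (Base B) a)).
        cartesian (Tot B) (Base B) (Proj B) (Lift B a Y) \<and>
        amap (Proj B) (Lift B a Y) = a \<and> Tgt (Tot B) (Lift B a Y) = Y) \<and>
     (\<forall>X\<in>Obj (fibre B (Src (Base B) a)).
        opcartesian (Tot B) (Base B) (Proj B) (Oplift B a X) \<and>
        amap (Proj B) (Oplift B a X) = a \<and> Src (Tot B) (Oplift B a X) = X))"

text \<open>Strictness is required of the functors only. That the chosen lifts themselves compose strictly
  would imply it and is not assumed.\<close>

definition strict_inverse_images :: "('o, 'm, 'p, 'n) bifib \<Rightarrow> bool" where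
  "strict_inverse_images B \<longleftrightarrow>
     (\<forall>Z\<in>Obj (Base B). ftor_eq (fibre B Z) (inverse_image B (Idt (Base B) Z)) id_ftor) \<and>
     (\<forall>a\<in>Arr (Base B). \<forall>b\<in>Arr (Base B). Tgt (Base B) b = Src (Base B) a \<longrightarrow>
        ftor_eq (fibre B (Tgt (Base B) a))
          (inverse_image B (a \<cdot>\<^bsub>Base B\<^esub> b)) (inverse_image B b \<circ>\<^sub>F inverse_image B a))"

definition strict_direct_images :: "('o, 'm, 'p, 'n) bifib \<Rightarrow> bool" where
  "strict_direct_images B \<longleftrightarrow>
     (\<forall>Z\<in>Obj (Base B). ftor_eq (fibre B Z) (direct_image B (Idt (Base B) Z)) id_ftor) \<and>
     (\<forall>a\<in>Arr (Base B). \<forall>b\<in>Arr (Base B). Tgt (Base B) b = Src (Base B) a \<longrightarrow>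
        ftor_eq (fibre B (Src (Base B) b))
          (direct_image B (a \<cdot>\<^bsub>Base B\<^esub> b)) (direct_image B a \<circ>\<^sub>F direct_image B b))"

definition strict_adjunctions :: "('o, 'm, 'p, 'n) bifib \<Rightarrow> bool" where
  "strict_adjunctions B \<longleftrightarrow>
     (\<forall>a\<in>Arr (Base B). \<forall>b\<in>Arr (Base B). Tgt (Base B) b = Src (Base B) a \<longrightarrow>
        (\<forall>X\<in>Obj (fibre B (Src (Base B) b)).
           adj_unit B (a \<cdot>\<^bsub>Base B\<^esub> b) X =
             amap (inverse_image B b) (adj_unit B a (omap (direct_image B b) X)) \<cdot>\<^bsub>Tot B\<^esub> adj_unit B b X) \<and>
        (\<forall>Y\<in>Obj (fibre B (Tgt (Base B) a)).
           adj_counit B (a \<cdot>\<^bsub>Base B\<^esub> b) Y =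
             adj_counit B a Y \<cdot>\<^bsub>Tot B\<^esub> amap (direct_image B a) (adj_counit B b (omap (inverse_image B a) Y))))"


section \<open>The monad of an arrow and the exchange morphisms\<close>

definition monad_ftor :: "('o, 'm, 'p, 'n) bifib \<Rightarrow> 'n \<Rightarrow> ('o, 'm, 'o, 'm) ftor" where
  "monad_ftor B a = inverse_image B a \<circ>\<^sub>F direct_image B a"

definition monad_mult :: "('o, 'm, 'p, 'n) bifib \<Rightarrow> 'n \<Rightarrow> 'o \<Rightarrow> 'm" where
  "monad_mult B a X = amap (inverse_image B a) (adj_counit B a (omap (direct_image B a) X))"

definition monad_algebras :: "('o, 'm, 'p, 'n) bifib \<Rightarrow> 'n
    \<Rightarrow> ('o \<times> 'm, ('o \<times> 'm) \<times> 'm \<times> ('o \<times> 'm)) cat" where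
  "monad_algebras B a =
     algebras (fibre B (Src (Base B) a)) (monad_ftor B a) (adj_unit B a) (monad_mult B a)"

definition comparison :: "('o, 'm, 'p, 'n) bifib \<Rightarrow> 'n
    \<Rightarrow> ('o, 'm, 'o \<times> 'm, ('o \<times> 'm) \<times> 'm \<times> ('o \<times> 'm)) ftor" where
  "comparison B a =
     (let K = (\<lambda>Y. (omap (inverse_image B a) Y, amap (inverse_image B a) (adj_counit B a Y))) in
      \<lparr>omap = K,
       amap = (\<lambda>f. (K (Src (Tot B) f), amap (inverse_image B a) f, K (Tgt (Tot B) f)))\<rparr>)"

text \<open>\<open>exch_chi\<close> is defined for \<open>a \<cdot> a1 = a \<cdot> a2\<close>, and has components from
  \<open>a2\<^sub>* a1\<^sup>* X\<close> to \<open>a\<^sup>* a\<^sub>* X\<close>: the target \<open>a1\<^sup>* a\<^sup>* a\<^sub>* X\<close> of the inverse image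
  of the unit is also \<open>a2\<^sup>* a\<^sup>* a\<^sub>* X\<close> by strictness.
  Likewise \<open>exch_lambda\<close>, for \<open>a1 \<cdot> p1 = a2 \<cdot> p3\<close>, has components from
  \<open>p1\<^sub>* p3\<^sup>* X\<close> to \<open>a1\<^sup>* a2\<^sub>* X\<close>.\<close>

definition exch_chi ::
    "('o, 'm, 'p, 'n) bifib \<Rightarrow> 'n \<Rightarrow> 'n \<Rightarrow> 'n \<Rightarrow> 'o \<Rightarrow> 'm" where
  "exch_chi B a a1 a2 X =
     adj_counit B a2 (omap (monad_ftor B a) X) \<cdot>\<^bsub>Tot B\<^esub>
     amap (direct_image B a2) (amap (inverse_image B a1) (adj_unit B a X))"

definition exch_lambda ::
    "('o, 'm, 'p, 'n) bifib \<Rightarrow> 'n \<Rightarrow> 'n \<Rightarrow> 'n \<Rightarrow> 'n \<Rightarrow> 'o \<Rightarrow> 'm" where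
  "exch_lambda B a1 a2 p1 p3 X =
     adj_counit B p1 (omap (inverse_image B a1) (omap (direct_image B a2) X)) \<cdot>\<^bsub>Tot B\<^esub>
     amap (direct_image B p1) (amap (inverse_image B p3) (adj_unit B a2 X))"

definition weak_exchange ::
    "('o, 'm, 'p, 'n) bifib \<Rightarrow> 'n \<Rightarrow> 'n \<Rightarrow> 'n \<Rightarrow> 'n \<Rightarrow> 'n \<Rightarrow> bool" where
  "weak_exchange B a a1 a2 p1 p3 \<longleftrightarrow>
     (let A1 = Src (Base B) a; A2 = Src (Base B) a2 in
      (\<forall>X\<in>Obj (fibre B A1). epi (fibre B A1) (exch_chi B a a1 a2 X)) \<and>
      (\<forall>X\<in>Obj (fibre B A2). epi (fibre B A2) (exch_lambda B a1 a2 p1 p3 X)))"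

end

theory Submission
  imports Defs
begin

text \<open>If \<open>\<phi>\<close> is a retraction of \<open>\<eta>\<^sub>M\<close>, the idempotent \<open>\<eta>\<^sub>M \<phi>\<close> is, by fullness, \<open>a\<^sup>* h\<close> for
  some endomorphism \<open>h\<close> of \<open>a\<^sub>* M\<close>, and \<open>h\<close> is the identity because it fixes the opcartesian
  arrow \<open>M \<rightarrow> a\<^sub>* M\<close>. So \<open>\<phi>\<close> is inverse to \<open>\<eta>\<^sub>M\<close>, whence \<open>a\<^sub>* \<phi> = \<epsilon>\<close> at \<open>a\<^sub>* M\<close>. Applying
  \<open>a\<^sup>*\<close> gives associativity, and shows that \<open>\<phi>\<close> is an isomorphism from the image of \<open>a\<^sub>* M\<close>
  under the comparison functor to \<open>(M, \<phi>)\<close>.\<close>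

section \<open>Arrows of fibres and of algebra categories\<close>

lemma hom_fibre_iff:
  "f \<in> hom (fibre B A) X Y \<longleftrightarrow> f \<in> hom (Tot B) X Y \<and> omap (Proj B) X = A \<and>
     omap (Proj B) Y = A \<and> amap (Proj B) f = Idt (Base B) A"
  by (auto simp: hom_def fibre_def)

lemma Obj_fibre_iff:
  "X \<in> Obj (fibre B A) \<longleftrightarrow> X \<in> Obj (Tot B) \<and> omap (Proj B) X = A"
  by (auto simp: fibre_def)

lemma fibre_simps [simp]:
  "Cmp (fibre B A) = Cmp (Tot B)" "Idt (fibre B A) = Idt (Tot B)"
  by (simp_all add: fibre_def)

lemma homD: "f \<in> hom C X Y \<Longrightarrow> f \<in> Arr C \<and> Src C f = X \<and> Tgt C f = Y"
  by (simp add: hom_def)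

lemma hom_algebras_iff:
  "((X, \<phi>), f, (Y, \<psi>)) \<in> hom (algebras C T \<eta> \<mu>) (X, \<phi>) (Y, \<psi>) \<longleftrightarrow>
     unital_algebra C T \<eta> X \<phi> \<and> associative_algebra C T \<mu> X \<phi> \<and>
     unital_algebra C T \<eta> Y \<psi> \<and> associative_algebra C T \<mu> Y \<psi> \<and>
     f \<in> hom C X Y \<and> f \<cdot>\<^bsub>C\<^esub> \<phi> = \<psi> \<cdot>\<^bsub>C\<^esub> amap T f"
  unfolding hom_def[of "algebras C T \<eta> \<mu>"] by (simp add: algebras_def Let_def)

text \<open>One adjunction at a time: all facts about \<open>a\<^sup>*\<close>,
  \<open>a\<^sub>*\<close>, unit and counit are derived from the two families of chosen universal
  arrows over this single \<open>a\<close>.\<close>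

locale lifted_arrow =
  fixes B :: "('o, 'm, 'p, 'n) bifib" and a :: 'n and A0 A1 :: 'p
  assumes proj: "is_functor (Tot B) (Base B) (Proj B)"
    and lifts: "chosen_lifts B"
    and arrow: "a \<in> hom (Base B) A1 A0"
begin

sublocale is_functor "Tot B" "Base B" "Proj B"
  by (rule proj)

abbreviation cmp (infixr "\<bullet>" 70) where "cmp \<equiv> Cmp (Tot B)"
abbreviation V0 where "V0 \<equiv> fibre B A0"
abbreviation V1 where "V1 \<equiv> fibre B A1"
abbreviation inv_o where "inv_o \<equiv> omap (inverse_image B a)"
abbreviation inv_m where "inv_m \<equiv> amap (inverse_image B a)"
abbreviation dir_o where "dir_o \<equiv> omap (direct_image B a)"
abbreviation dir_m where "dir_m \<equiv> amap (direct_image B a)"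
abbreviation lft where "lft \<equiv> Lift B a"
abbreviation opl where "opl \<equiv> Oplift B a"
abbreviation unit where "unit \<equiv> adj_unit B a"
abbreviation counit where "counit \<equiv> adj_counit B a"

lemma arrow_simps: "a \<in> Arr (Base B)" "Src (Base B) a = A1" "Tgt (Base B) a = A0"
  using arrow by (auto simp: hom_def)

section \<open>Vertical arrows and the universal arrows over \<open>a\<close>\<close>

lemma vertical_in_fibre:
  assumes "f \<in> hom (fibre B A) X Y"
  shows "X \<in> Obj (fibre B A)" "Y \<in> Obj (fibre B A)" "f \<in> hom (Tot B) X Y"
proof -
  note f = assms[unfolded hom_fibre_iff]
  show "f \<in> hom (Tot B) X Y" using f by simp
  then show "X \<in> Obj (fibre B A)" "Y \<in> Obj (fibre B A)"
    using f homD source.Src_in source.Tgt_in by (fastforce simp: Obj_fibre_iff)+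
qed

lemma vertical_Idt: "X \<in> Obj (fibre B A) \<Longrightarrow> Idt (Tot B) X \<in> hom (fibre B A) X X"
  using amap_Idt source.Idt_hom by (auto simp: hom_fibre_iff Obj_fibre_iff)

lemma vertical_Cmp:
  assumes "f \<in> hom (fibre B A) X Y" "g \<in> hom (fibre B A) Y Z"
  shows "g \<bullet> f \<in> hom (fibre B A) X Z"
proof -
  have "X \<in> Obj (Tot B)" "omap (Proj B) X = A"
    using vertical_in_fibre(1)[OF assms(1)] by (auto simp: Obj_fibre_iff)
  \<comment> \<open>The index \<open>A\<close> of the fibre is an object of the base because it is
    the projection of \<open>X\<close>.\<close>
  then have "Idt (Base B) A \<in> hom (Base B) A A"
    using omap_in target.Idt_hom by blast
  then show ?thesis
    using assms amap_Cmp source.Cmp_hom target.Idt_left by (fastforce simp: hom_fibre_iff)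
qed

lemma lft_hom:
  assumes "Y \<in> Obj V0"
  shows "cartesian (Tot B) (Base B) (Proj B) (lft Y)" "lft Y \<in> hom (Tot B) (inv_o Y) Y"
    "amap (Proj B) (lft Y) = a" "inv_o Y \<in> Obj V1"
proof -
  have l: "cartesian (Tot B) (Base B) (Proj B) (lft Y)" "amap (Proj B) (lft Y) = a"
      "Tgt (Tot B) (lft Y) = Y"
    using lifts assms arrow_simps unfolding chosen_lifts_def by auto
  then have h: "lft Y \<in> hom (Tot B) (inv_o Y) Y"
    by (simp add: cartesian_def hom_def inverse_image_def)
  \<comment> \<open>The lift projects to \<open>a\<close>, so its source must lie over the source of
    \<open>a\<close>.\<close>
  then have "a \<in> hom (Base B) (omap (Proj B) (inv_o Y)) (omap (Proj B) Y)"
    using amap_hom l(2) by fastforce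
  then have "omap (Proj B) (inv_o Y) = A1"
    using arrow by (simp add: hom_def)
  then show "inv_o Y \<in> Obj V1"
    using homD[OF h] source.Src_in[of "lft Y"] by (simp add: Obj_fibre_iff)
qed (use lifts assms arrow_simps in \<open>auto simp: chosen_lifts_def cartesian_def hom_def inverse_image_def\<close>)

lemma opl_hom:
  assumes "X \<in> Obj V1"
  shows "opcartesian (Tot B) (Base B) (Proj B) (opl X)" "opl X \<in> hom (Tot B) X (dir_o X)"
    "amap (Proj B) (opl X) = a" "dir_o X \<in> Obj V0"
proof -
  have l: "opcartesian (Tot B) (Base B) (Proj B) (opl X)" "amap (Proj B) (opl X) = a"
      "Src (Tot B) (opl X) = X"
    using lifts assms arrow_simps unfolding chosen_lifts_def by auto
  then have h: "opl X \<in> hom (Tot B) X (dir_o X)"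
    by (simp add: opcartesian_def hom_def direct_image_def)
  then have "a \<in> hom (Base B) (omap (Proj B) X) (omap (Proj B) (dir_o X))"
    using amap_hom l(2) by fastforce
  then have "omap (Proj B) (dir_o X) = A0"
    using arrow by (simp add: hom_def)
  then show "dir_o X \<in> Obj V0"
    using homD[OF h] source.Tgt_in[of "opl X"] by (simp add: Obj_fibre_iff)
qed (use lifts assms arrow_simps in \<open>auto simp: chosen_lifts_def opcartesian_def hom_def direct_image_def\<close>)

text \<open>Cartesianness specialised to the base arrow \<open>Idt (Base B) A1\<close>: since
  \<open>a\<close> composed with this identity is \<open>a\<close>, the factorisation it provides is
  vertical. This is the form in which the definite descriptions of \<open>inverse_image\<close> and
  \<open>adj_unit\<close> are stated.\<close>

lemma lft_factor:
  assumes "X \<in> Obj V1" "Y \<in> Obj V0" "g \<in> hom (Tot B) X Y" "amap (Proj B) g = a"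
  shows "\<exists>!h. h \<in> hom V1 X (inv_o Y) \<and> lft Y \<bullet> h = g"
proof -
  note l = lft_hom[OF assms(2)]
  have X: "X \<in> Obj (Tot B)" "omap (Proj B) X = A1" and Y: "omap (Proj B) (inv_o Y) = A1"
    using assms(1) l(4) by (auto simp: Obj_fibre_iff)
  then have "Idt (Base B) A1 \<in> hom (Base B) A1 A1"
    using omap_in target.Idt_hom by blast
  then have "\<exists>!h. h \<in> hom (Tot B) X (inv_o Y) \<and> amap (Proj B) h = Idt (Base B) A1 \<and> lft Y \<bullet> h = g"
    using l(1) X Y assms(3,4) homD[OF l(2)] l(3) target.Idt_right[OF arrow]
    unfolding cartesian_def by auto
  then show ?thesis using X Y by (simp add: hom_fibre_iff conj_assoc)
qed

text \<open>Dual of \<open>lft_factor\<close>, with the identity of \<open>A0\<close> as base arrow;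
  it serves \<open>direct_image\<close> and \<open>adj_counit\<close>.\<close>

lemma opl_factor:
  assumes "X \<in> Obj V1" "Y \<in> Obj V0" "g \<in> hom (Tot B) X Y" "amap (Proj B) g = a"
  shows "\<exists>!h. h \<in> hom V0 (dir_o X) Y \<and> h \<bullet> opl X = g"
proof -
  note l = opl_hom[OF assms(1)]
  have Y: "Y \<in> Obj (Tot B)" "omap (Proj B) Y = A0" and X: "omap (Proj B) (dir_o X) = A0"
    using assms(2) l(4) by (auto simp: Obj_fibre_iff)
  then have "Idt (Base B) A0 \<in> hom (Base B) A0 A0"
    using omap_in target.Idt_hom by blast
  then have "\<exists>!h. h \<in> hom (Tot B) (dir_o X) Y \<and> amap (Proj B) h = Idt (Base B) A0 \<and> h \<bullet> opl X = g"
    using l(1) X Y assms(3,4) homD[OF l(2)] l(3) target.Idt_left[OF arrow]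
    unfolding opcartesian_def by auto
  then show ?thesis using X Y by (simp add: hom_fibre_iff conj_assoc)
qed

text \<open>A vertical arrow projects to an identity, so composing with it on either side leaves the
  projection equal to \<open>a\<close>.\<close>

lemma Cmp_over_arrow:
  assumes "X \<in> Obj V1" "Y \<in> Obj V0" "g \<in> hom (Tot B) X Y" "amap (Proj B) g = a"
  shows "f \<in> hom V0 Y Y' \<Longrightarrow> f \<bullet> g \<in> hom (Tot B) X Y' \<and> amap (Proj B) (f \<bullet> g) = a"
    and "f' \<in> hom V1 X' X \<Longrightarrow> g \<bullet> f' \<in> hom (Tot B) X' Y \<and> amap (Proj B) (g \<bullet> f') = a"
  using assms source.Cmp_hom[of f' X' X g Y] source.Cmp_hom[of g X Y f Y']
    amap_Cmp[of f' X' X g Y] amap_Cmp[of g X Y f Y'] target.Idt_left[OF arrow]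
    target.Idt_right[OF arrow]
  by (auto simp: hom_fibre_iff)

text \<open>The uniqueness half of \<open>lft_factor\<close>. Equations between vertical arrows into
  an inverse image are proved by composing both sides with the lift.\<close>

lemma lft_cancel:
  assumes "Y \<in> Obj V0" "h \<in> hom V1 X (inv_o Y)" "h' \<in> hom V1 X (inv_o Y)"
    "lft Y \<bullet> h = lft Y \<bullet> h'"
  shows "h = h'"
proof -
  note l = lft_hom[OF assms(1)] and X = vertical_in_fibre(1)[OF assms(2)]
  have "lft Y \<bullet> h \<in> hom (Tot B) X Y" "amap (Proj B) (lft Y \<bullet> h) = a"
    using Cmp_over_arrow(2)[OF l(4) assms(1) l(2,3) assms(2)] by auto
  from lft_factor[OF X assms(1) this] show ?thesis using assms by auto
qed

text \<open>The uniqueness half of \<open>opl_factor\<close>, for equations between vertical arrows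
  out of a direct image.\<close>

lemma opl_cancel:
  assumes "X \<in> Obj V1" "h \<in> hom V0 (dir_o X) Y" "h' \<in> hom V0 (dir_o X) Y"
    "h \<bullet> opl X = h' \<bullet> opl X"
  shows "h = h'"
proof -
  note l = opl_hom[OF assms(1)] and Y = vertical_in_fibre(2)[OF assms(2)]
  have "h \<bullet> opl X \<in> hom (Tot B) X Y" "amap (Proj B) (h \<bullet> opl X) = a"
    using Cmp_over_arrow(1)[OF assms(1) l(4) l(2,3) assms(2)] by auto
  from opl_factor[OF assms(1) Y this] show ?thesis using assms by auto
qed

section \<open>Functoriality of the two images, unit and counit\<close>

lemma inv_m:
  assumes "f \<in> hom V0 Y Y'"
  shows "inv_m f \<in> hom V1 (inv_o Y) (inv_o Y')" "lft Y' \<bullet> inv_m f = f \<bullet> lft Y"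
proof -
  note Y = vertical_in_fibre[OF assms]
  note l = lft_hom[OF Y(1)]
  have "f \<bullet> lft Y \<in> hom (Tot B) (inv_o Y) Y'" "amap (Proj B) (f \<bullet> lft Y) = a"
    using Cmp_over_arrow(1)[OF l(4) Y(1) l(2,3) assms] by auto
  \<comment> \<open>Unique factorisation makes the definite description in
    \<open>inverse_image\<close> meaningful, so the arrow it denotes satisfies the defining
    equation. The same device handles \<open>dir_m\<close>, \<open>unit\<close> and
    \<open>counit\<close>.\<close>
  from theI'[OF lft_factor[OF l(4) Y(2) this]]
  show "inv_m f \<in> hom V1 (inv_o Y) (inv_o Y')" "lft Y' \<bullet> inv_m f = f \<bullet> lft Y"
    using homD[OF Y(3)] arrow_simps by (simp_all add: inverse_image_def)
qed

lemma dir_m: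
  assumes "f \<in> hom V1 X X'"
  shows "dir_m f \<in> hom V0 (dir_o X) (dir_o X')" "dir_m f \<bullet> opl X = opl X' \<bullet> f"
proof -
  note X = vertical_in_fibre[OF assms]
  note l = opl_hom[OF X(2)]
  have "opl X' \<bullet> f \<in> hom (Tot B) X (dir_o X')" "amap (Proj B) (opl X' \<bullet> f) = a"
    using Cmp_over_arrow(2)[OF X(2) l(4) l(2,3) assms] by auto
  from theI'[OF opl_factor[OF X(1) l(4) this]]
  show "dir_m f \<in> hom V0 (dir_o X) (dir_o X')" "dir_m f \<bullet> opl X = opl X' \<bullet> f"
    using homD[OF X(3)] arrow_simps by (simp_all add: direct_image_def)
qed

lemma unit:
  assumes "X \<in> Obj V1"
  shows "unit X \<in> hom V1 X (inv_o (dir_o X))" "lft (dir_o X) \<bullet> unit X = opl X"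
proof -
  note l = opl_hom[OF assms]
  from theI'[OF lft_factor[OF assms l(4,2,3)]]
  show "unit X \<in> hom V1 X (inv_o (dir_o X))" "lft (dir_o X) \<bullet> unit X = opl X"
    using arrow_simps by (simp_all add: adj_unit_def)
qed

lemma counit:
  assumes "Y \<in> Obj V0"
  shows "counit Y \<in> hom V0 (dir_o (inv_o Y)) Y" "counit Y \<bullet> opl (inv_o Y) = lft Y"
proof -
  note l = lft_hom[OF assms]
  from theI'[OF opl_factor[OF l(4) assms l(2,3)]]
  show "counit Y \<in> hom V0 (dir_o (inv_o Y)) Y" "counit Y \<bullet> opl (inv_o Y) = lft Y"
    using arrow_simps by (simp_all add: adj_counit_def)
qed

lemma inv_m_Idt:
  assumes "Y \<in> Obj V0"
  shows "inv_m (Idt (Tot B) Y) = Idt (Tot B) (inv_o Y)"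
proof (rule lft_cancel[OF assms])
  note l = lft_hom[OF assms]
  show "inv_m (Idt (Tot B) Y) \<in> hom V1 (inv_o Y) (inv_o Y)"
    using inv_m vertical_Idt assms by blast
  show "Idt (Tot B) (inv_o Y) \<in> hom V1 (inv_o Y) (inv_o Y)"
    using vertical_Idt l by blast
  show "lft Y \<bullet> inv_m (Idt (Tot B) Y) = lft Y \<bullet> Idt (Tot B) (inv_o Y)"
    using inv_m(2)[OF vertical_Idt[OF assms]] source.Idt_left[OF l(2)] source.Idt_right[OF l(2)]
    by simp
qed

lemma dir_m_Idt:
  assumes "X \<in> Obj V1"
  shows "dir_m (Idt (Tot B) X) = Idt (Tot B) (dir_o X)"
proof (rule opl_cancel[OF assms])
  note l = opl_hom[OF assms]
  show "dir_m (Idt (Tot B) X) \<in> hom V0 (dir_o X) (dir_o X)"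
    using dir_m vertical_Idt assms by blast
  show "Idt (Tot B) (dir_o X) \<in> hom V0 (dir_o X) (dir_o X)"
    using vertical_Idt l by blast
  show "dir_m (Idt (Tot B) X) \<bullet> opl X = Idt (Tot B) (dir_o X) \<bullet> opl X"
    using dir_m(2)[OF vertical_Idt[OF assms]] source.Idt_left[OF l(2)] source.Idt_right[OF l(2)]
    by simp
qed

lemma inv_m_Cmp:
  assumes f: "f \<in> hom V0 X Y" and g: "g \<in> hom V0 Y Z"
  shows "inv_m (g \<bullet> f) = inv_m g \<bullet> inv_m f"
proof (rule lft_cancel)
  note v = vertical_in_fibre[OF f] vertical_in_fibre[OF g]
  note iv = vertical_in_fibre(3)[OF inv_m(1)[OF f]] vertical_in_fibre(3)[OF inv_m(1)[OF g]]
  note l = lft_hom(2)[OF v(1)] lft_hom(2)[OF v(2)] lft_hom(2)[OF v(5)]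
  note gf = vertical_Cmp[OF f g]
  show "Z \<in> Obj V0" by (rule v)
  show "inv_m (g \<bullet> f) \<in> hom V1 (inv_o X) (inv_o Z)" by (rule inv_m[OF gf])
  show "inv_m g \<bullet> inv_m f \<in> hom V1 (inv_o X) (inv_o Z)"
    by (rule vertical_Cmp[OF inv_m(1)[OF f] inv_m(1)[OF g]])
  \<comment> \<open>The two naturality squares, for \<open>f\<close> and then for \<open>g\<close>,
    carry the lift from \<open>X\<close> past \<open>Y\<close> to \<open>Z\<close>.\<close>
  have "lft Z \<bullet> inv_m (g \<bullet> f) = (g \<bullet> f) \<bullet> lft X" by (rule inv_m[OF gf])
  also have "\<dots> = g \<bullet> (lft Y \<bullet> inv_m f)"
    using source.Cmp_assoc[OF l(1) v(3,6)] inv_m(2)[OF f] by simp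
  also have "\<dots> = (lft Z \<bullet> inv_m g) \<bullet> inv_m f"
    using source.Cmp_assoc[OF iv(1) l(2) v(6)] inv_m(2)[OF g] by simp
  also have "\<dots> = lft Z \<bullet> inv_m g \<bullet> inv_m f"
    by (rule source.Cmp_assoc[OF iv l(3)])
  finally show "lft Z \<bullet> inv_m (g \<bullet> f) = lft Z \<bullet> inv_m g \<bullet> inv_m f" .
qed

lemma dir_m_Cmp:
  assumes f: "f \<in> hom V1 X Y" and g: "g \<in> hom V1 Y Z"
  shows "dir_m (g \<bullet> f) = dir_m g \<bullet> dir_m f"
proof (rule opl_cancel)
  note v = vertical_in_fibre[OF f] vertical_in_fibre[OF g]
  note iv = vertical_in_fibre(3)[OF dir_m(1)[OF f]] vertical_in_fibre(3)[OF dir_m(1)[OF g]]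
  note l = opl_hom(2)[OF v(1)] opl_hom(2)[OF v(2)] opl_hom(2)[OF v(5)]
  note gf = vertical_Cmp[OF f g]
  show "X \<in> Obj V1" by (rule v)
  show "dir_m (g \<bullet> f) \<in> hom V0 (dir_o X) (dir_o Z)" by (rule dir_m[OF gf])
  show "dir_m g \<bullet> dir_m f \<in> hom V0 (dir_o X) (dir_o Z)"
    by (rule vertical_Cmp[OF dir_m(1)[OF f] dir_m(1)[OF g]])
  have "dir_m (g \<bullet> f) \<bullet> opl X = opl Z \<bullet> g \<bullet> f" by (rule dir_m[OF gf])
  also have "\<dots> = (dir_m g \<bullet> opl Y) \<bullet> f"
    using source.Cmp_assoc[OF v(3,6) l(3)] dir_m(2)[OF g] by simp
  also have "\<dots> = dir_m g \<bullet> (dir_m f \<bullet> opl X)"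
    using source.Cmp_assoc[OF v(3) l(2) iv(2)] dir_m(2)[OF f] by simp
  also have "\<dots> = (dir_m g \<bullet> dir_m f) \<bullet> opl X"
    by (rule source.Cmp_assoc[OF l(1) iv, symmetric])
  finally show "dir_m (g \<bullet> f) \<bullet> opl X = (dir_m g \<bullet> dir_m f) \<bullet> opl X" .
qed

section \<open>The monad of \<open>a\<close> and its algebras\<close>

lemma monad_simps:
  "omap (monad_ftor B a) X = inv_o (dir_o X)" "amap (monad_ftor B a) f = inv_m (dir_m f)"
  "monad_mult B a X = inv_m (counit (dir_o X))"
  by (simp_all add: monad_ftor_def ftor_comp_def monad_mult_def)

abbreviation unital where
  "unital \<equiv> unital_algebra V1 (monad_ftor B a) (adj_unit B a)"
abbreviation associative where
  "associative \<equiv> associative_algebra V1 (monad_ftor B a) (monad_mult B a)"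

lemma unital_iff: "unital X \<phi> \<longleftrightarrow>
    X \<in> Obj V1 \<and> \<phi> \<in> hom V1 (inv_o (dir_o X)) X \<and> \<phi> \<bullet> unit X = Idt (Tot B) X"
  by (simp add: unital_algebra_def monad_simps)

lemma associative_iff: "associative X \<phi> \<longleftrightarrow>
    X \<in> Obj V1 \<and> \<phi> \<in> hom V1 (inv_o (dir_o X)) X \<and>
    \<phi> \<bullet> inv_m (dir_m \<phi>) = \<phi> \<bullet> inv_m (counit (dir_o X))"
  by (simp add: associative_algebra_def monad_simps)

text \<open>This is a triangle identity of the adjunction: \<open>a\<^sup>*\<close> of the counit
  retracts the unit at \<open>inv_o Y\<close>.\<close>

lemma unital_comparison:
  assumes "Y \<in> Obj V0"
  shows "unital (inv_o Y) (inv_m (counit Y))"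
proof -
  note l = lft_hom[OF assms] and c = counit[OF assms]
  note u = unit[OF l(4)] and i = inv_m[OF c(1)]
  note Z = opl_hom(4)[OF l(4)]
  have "inv_m (counit Y) \<bullet> unit (inv_o Y) = Idt (Tot B) (inv_o Y)"
  proof (rule lft_cancel[OF assms vertical_Cmp[OF u(1) i(1)] vertical_Idt[OF l(4)]])
    have "lft Y \<bullet> inv_m (counit Y) \<bullet> unit (inv_o Y) = (counit Y \<bullet> lft (dir_o (inv_o Y))) \<bullet> unit (inv_o Y)"
      using source.Cmp_assoc[OF vertical_in_fibre(3)[OF u(1)] vertical_in_fibre(3)[OF i(1)] l(2)] i(2)
      by simp
    \<comment> \<open>The unit turns the lift at \<open>dir_o (inv_o Y)\<close> into
      \<open>opl (inv_o Y)\<close>, and the counit turns that into \<open>lft Y\<close>.\<close>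
    also have "\<dots> = lft Y"
      using source.Cmp_assoc[OF vertical_in_fibre(3)[OF u(1)] lft_hom(2)[OF Z] vertical_in_fibre(3)[OF c(1)]] u(2) c(2)
      by simp
    finally show "lft Y \<bullet> inv_m (counit Y) \<bullet> unit (inv_o Y) = lft Y \<bullet> Idt (Tot B) (inv_o Y)"
      using source.Idt_right[OF l(2)] by simp
  qed
  then show ?thesis using i(1) l(4) by (simp add: unital_iff)
qed

end

section \<open>Consequences of fullness of \<open>a\<^sup>*\<close>\<close>

locale full_lifted_arrow = lifted_arrow +
  assumes full: "\<lbrakk>X \<in> Obj V0; Y \<in> Obj V0; g \<in> hom V1 (inv_o X) (inv_o Y)\<rbrakk>
    \<Longrightarrow> \<exists>h\<in>hom V0 X Y. inv_m h = g"
begin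

text \<open>The retraction \<open>\<phi>\<close> becomes a two-sided inverse of the unit: fullness
  descends the idempotent to \<open>V0\<close>, where maps out of \<open>dir_o X\<close> are tested
  on \<open>opl X\<close>.\<close>

lemma unit_unital:
  assumes "unital X \<phi>"
  shows "unit X \<bullet> \<phi> = Idt (Tot B) (inv_o (dir_o X))"
proof -
  have X: "X \<in> Obj V1" and p: "\<phi> \<in> hom V1 (inv_o (dir_o X)) X" and pu: "\<phi> \<bullet> unit X = Idt (Tot B) X"
    using assms by (auto simp: unital_iff)
  note u = unit[OF X] and o = opl_hom[OF X]
  note l = lft_hom[OF o(4)]
  note u' = vertical_in_fibre(3)[OF u(1)] and p' = vertical_in_fibre(3)[OF p]
  have up: "unit X \<bullet> \<phi> \<in> hom V1 (inv_o (dir_o X)) (inv_o (dir_o X))"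
    by (rule vertical_Cmp[OF p u(1)])
  from full[OF o(4) o(4) this]
  obtain h where h: "h \<in> hom V0 (dir_o X) (dir_o X)" "inv_m h = unit X \<bullet> \<phi>" by blast
  \<comment> \<open>Writing \<open>opl X\<close> as the lift after the unit allows \<open>h\<close>
    to be replaced by \<open>inv_m h\<close>, which is known.\<close>
  have "h \<bullet> opl X = (h \<bullet> lft (dir_o X)) \<bullet> unit X"
    using source.Cmp_assoc[OF u' l(2) vertical_in_fibre(3)[OF h(1)]] u(2) by simp
  also have "\<dots> = lft (dir_o X) \<bullet> (unit X \<bullet> \<phi>) \<bullet> unit X"
    using source.Cmp_assoc[OF u' vertical_in_fibre(3)[OF up] l(2)] inv_m(2)[OF h(1)] h(2) by simp
  \<comment> \<open>Unitality collapses \<open>unit X \<bullet> \<phi> \<bullet> unit X\<close> to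
    \<open>unit X\<close>.\<close>
  also have "\<dots> = Idt (Tot B) (dir_o X) \<bullet> opl X"
    using source.Cmp_assoc[OF u' p' u'] pu source.Idt_right[OF u'] u(2) source.Idt_left[OF o(2)]
    by simp
  finally have "h = Idt (Tot B) (dir_o X)"
    using opl_cancel[OF X h(1) vertical_Idt[OF o(4)]] by blast
  then show ?thesis using h(2) inv_m_Idt[OF o(4)] by simp
qed

text \<open>The counit is the only vertical arrow taking \<open>opl\<close> at
  \<open>inv_o (dir_o X)\<close> to the lift. So does \<open>dir_m \<phi>\<close>, by its defining
  square and \<open>unit_unital\<close>.\<close>

lemma dir_m_unital:
  assumes "unital X \<phi>"
  shows "dir_m \<phi> = counit (dir_o X)"
proof -
  have X: "X \<in> Obj V1" and p: "\<phi> \<in> hom V1 (inv_o (dir_o X)) X"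
    using assms by (auto simp: unital_iff)
  note u = unit[OF X] and o = opl_hom[OF X]
  note l = lft_hom[OF o(4)] and c = counit[OF o(4)]
  show ?thesis
  proof (rule opl_cancel[OF l(4) dir_m(1)[OF p] c(1)])
    have "dir_m \<phi> \<bullet> opl (inv_o (dir_o X)) = lft (dir_o X) \<bullet> unit X \<bullet> \<phi>"
      using dir_m(2)[OF p] u(2)
        source.Cmp_assoc[OF vertical_in_fibre(3)[OF p] vertical_in_fibre(3)[OF u(1)] l(2)] by simp
    also have "\<dots> = lft (dir_o X)"
      using unit_unital[OF assms] source.Idt_right[OF l(2)] by simp
    finally show "dir_m \<phi> \<bullet> opl (inv_o (dir_o X)) = counit (dir_o X) \<bullet> opl (inv_o (dir_o X))"
      using c(2) by simp
  qed
qed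

text \<open>Applying \<open>a\<^sup>*\<close> to \<open>dir_m_unital\<close> identifies
  \<open>T\<phi>\<close> with the multiplication at \<open>X\<close>, before any composition with
  \<open>\<phi>\<close>.\<close>

lemma unital_associative: "unital X \<phi> \<Longrightarrow> associative X \<phi>"
  using dir_m_unital by (auto simp: unital_iff associative_iff)

text \<open>The preimage of \<open>(X, \<phi>)\<close> is \<open>dir_o X\<close>; its image under
  the comparison is the free algebra on \<open>X\<close>, and \<open>\<phi>\<close> and
  \<open>unit X\<close> are the mutually inverse algebra morphisms.\<close>

lemma essentially_surjective_comparison:
  "essentially_surjective V0 (monad_algebras B a) (comparison B a)"
  unfolding essentially_surjective_def
proof
  fix A assume "A \<in> Obj (monad_algebras B a)"
  then obtain X \<phi> where A: "A = (X, \<phi>)" and un: "unital X \<phi>"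
    by (auto simp: monad_algebras_def algebras_def Let_def arrow_simps)
  then have X: "X \<in> Obj V1" and p: "\<phi> \<in> hom V1 (inv_o (dir_o X)) X" and pu: "\<phi> \<bullet> unit X = Idt (Tot B) X"
    by (auto simp: unital_iff)
  let ?Y = "dir_o X" and ?T = "inv_o (dir_o X)"
  note u = unit[OF X] and o = opl_hom[OF X]
  define K where "K = omap (comparison B a) ?Y"
  \<comment> \<open>The structure map is by definition \<open>a\<^sup>*\<close> of the counit; as
    \<open>T\<phi>\<close> it can be composed functorially with \<open>T\<close> of the
    unit.\<close>
  have K: "K = (?T, inv_m (dir_m \<phi>))"
    by (simp add: K_def comparison_def Let_def dir_m_unital[OF un])
  have "unital ?T (inv_m (dir_m \<phi>))"
    using unital_comparison[OF o(4)] dir_m_unital[OF un] by simp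
  \<comment> \<open>Associativity of the free algebra is an instance of the general result on unital
    algebras.\<close>
  note unK = this unital_associative[OF this]
  \<comment> \<open>This is the square making \<open>unit X\<close> an algebra morphism: both sides
    are the identity of \<open>?T\<close>, one by functoriality of \<open>T\<close>, the other by
    \<open>unit_unital\<close>.\<close>
  have "inv_m (dir_m \<phi>) \<bullet> inv_m (dir_m (unit X)) = inv_m (dir_m (\<phi> \<bullet> unit X))"
    by (simp add: inv_m_Cmp[OF dir_m(1)[OF u(1)] dir_m(1)[OF p]] dir_m_Cmp[OF u(1) p])
  also have "\<dots> = unit X \<bullet> \<phi>"
    by (simp add: pu dir_m_Idt[OF X] inv_m_Idt[OF o(4)] unit_unital[OF un])
  finally have "(A, unit X, K) \<in> hom (monad_algebras B a) A K"
    using un unK unital_associative[OF un] u(1)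
    by (simp add: A K monad_algebras_def hom_algebras_iff arrow_simps monad_simps)
  \<comment> \<open>With the structure map of \<open>K\<close> written as \<open>T\<phi>\<close>,
    both sides of the square for \<open>\<phi>\<close> read
    \<open>\<phi> \<bullet> T\<phi>\<close>.\<close>
  moreover have "(K, \<phi>, A) \<in> hom (monad_algebras B a) K A"
    using un unK unital_associative[OF un] p
    by (simp add: A K monad_algebras_def hom_algebras_iff arrow_simps monad_simps)
  ultimately have "isomorphic (monad_algebras B a) K A"
    unfolding isomorphic_def
    by (intro bexI[of _ "(K, \<phi>, A)"] bexI[of _ "(A, unit X, K)"])
      (simp_all add: A K monad_algebras_def algebras_def Let_def pu unit_unital[OF un])
  then show "\<exists>Y\<in>Obj V0. isomorphic (monad_algebras B a) (omap (comparison B a) Y) A"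
    using o(4) K_def by blast
qed

end

theorem corollary0p5p2:
  fixes B :: "('o, 'm, 'p, 'n) bifib"
    and A0 A1 A2 A3 :: 'p
    and a a1 a2 p1 p2 p3 :: 'n
  assumes "bifibrant (Tot B) (Base B) (Proj B)"
    and "chosen_lifts B"
    and "strict_inverse_images B"
    and "strict_direct_images B"
    and "strict_adjunctions B"
    and "A0 \<in> Obj (Base B)" and "A1 \<in> Obj (Base B)"
    and "A2 \<in> Obj (Base B)" and "A3 \<in> Obj (Base B)"
    and "a \<in> hom (Base B) A1 A0"
    and "a1 \<in> hom (Base B) A2 A1" and "a2 \<in> hom (Base B) A2 A1"
    and "p1 \<in> hom (Base B) A3 A2" and "p2 \<in> hom (Base B) A3 A2" and "p3 \<in> hom (Base B) A3 A2"
    and "a \<cdot>\<^bsub>Base B\<^esub> a1 = a \<cdot>\<^bsub>Base B\<^esub> a2"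
    and "a1 \<cdot>\<^bsub>Base B\<^esub> p2 = a1 \<cdot>\<^bsub>Base B\<^esub> p3"
    and "a1 \<cdot>\<^bsub>Base B\<^esub> p1 = a2 \<cdot>\<^bsub>Base B\<^esub> p3"
    and "a2 \<cdot>\<^bsub>Base B\<^esub> p1 = a2 \<cdot>\<^bsub>Base B\<^esub> p2"
    and "weak_exchange B a a1 a2 p1 p3"
    and "fully_faithful (fibre B A0) (fibre B A1) (inverse_image B a)"
    and "karoubian (fibre B A0)"
  shows "(\<forall>M \<phi>. unital_algebra (fibre B A1) (monad_ftor B a) (adj_unit B a) M \<phi> \<longrightarrow>
            associative_algebra (fibre B A1) (monad_ftor B a) (monad_mult B a) M \<phi>) \<and>
         essentially_surjective (fibre B A0) (monad_algebras B a) (comparison B a)"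
proof -
  interpret lifted_arrow B a A0 A1
    by (rule lifted_arrow.intro) (use assms in \<open>auto simp: bifibrant_def fibration_def\<close>)
  interpret full_lifted_arrow B a A0 A1
  proof
    fix X Y g
    assume "X \<in> Obj V0" "Y \<in> Obj V0" "g \<in> hom V1 (inv_o X) (inv_o Y)"
    \<comment> \<open>Fullness is the surjectivity contained in the bijection on hom sets.\<close>
    moreover from this have "inv_m ` hom V0 X Y = hom V1 (inv_o X) (inv_o Y)"
      using assms(21) by (simp add: fully_faithful_def bij_betw_def)
    ultimately show "\<exists>h\<in>hom V0 X Y. inv_m h = g" by force
  qed
  show ?thesis
    using unital_associative essentially_surjective_comparison by blast
qed

end
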